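(* Let $c\in\mathbb{R}^n$, $L\in\mathbb{R}^{n\times n}$, and symmetric $Q^{(1)},\dots,Q^{(n)}\in\mathbb{R}^{n\times n}$ be such that $f(x)=(x^\top Q^{(i)}x)_{i=1}^n$ satisfies $x^\top f(x)=0$ for all $x\in\mathbb{R}^n$. Let $m\in\mathbb{R}^n$ be such that $A_s(m)\prec 0$ and $d(m)\neq 0$. Let $(R_m^* )^2$ be the optimal value of $$\max_{y\in\mathbb{R}^n}\; y^\top y \quad\text{subject to}\quad d(m)^\top y + y^\top A_s(m)y\ge 0, \qquad (\mathrm{P})$$ and let $(\lambda^*,\gamma^* )$ be an optimal solution of the dual semidefinite program $$\min_{\lambda\ge 0,\ \gamma\in\mathbb{R}}\; \gamma\quad\text{subject to}\quad \begin{bmatrix} I_n+\lambda A_s(m) & \frac{\lambda}{2}d(m)\\ \frac{\lambda}{2}d(m)^\top & -\gamma\end{bmatrix}\preceq 0 .$$ Let $r$ be the rank of $I_n+\lambda^*A_s(m)$ and let $V\in\mathbb{R}^{n\times(n-r)}$ have orthonormal columns spanning the null space of $I_n+\lambda^*A_s(m)$. Then the set of optimal solutions of $(\mathrm{P})$ is exactly $$\left\{ -\tfrac{\lambda^*}{2}\,(I_n+\lambda^*A_s(m))^\dagger d(m) + Vw \;:\; w\in\mathbb{R}^{n-r},\ \|w\|^2 = (R_m^* )^2-\tfrac{(\lambda^* )^2}{4}\, d(m)^\top\big((I_n+\lambda^*A_s(m))^\dagger\big)^2 d(m)\right\}.$$ That is, the optimal solutions form a hypersphere, centered at $-\frac{\lambda^*}{2}(I_n+\lambda^*A_s(m))^\dagger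 d(m)$, in the $(n-r)$-dimensional affine subspace through this point with directions given by the columns of $V$.
   Context: Here $d(m)=c+Lm+f(m)$ and $A_s(m)=\frac12(L+L^\top)-\sum_{k=1}^n m_kQ^{(k)}$. For symmetric matrices $\prec,\preceq$ denote the Loewner (definiteness) order, $I_n$ is the identity matrix, $\|\cdot\|$ is the Euclidean norm, and $(\cdot)^\dagger$ is the Moore–Penrose pseudoinverse. If $r=n$, then $V$ has no columns, $\mathbb{R}^{0}=\{0\}$, and $Vw=0$. A hypersphere in a $k$-dimensional affine space means the set of points at a fixed distance $\ge 0$ from the center; a radius of $0$ is allowed (for $k=1$ and positive radius it is a pair of points). *)

theory Defs
  imports "HOL-Analysis.Analysis"
begin

definition symmetric_matrix :: "real^'n^'n \<Rightarrow> bool" where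
  "symmetric_matrix M \<longleftrightarrow> transpose M = M"

text \<open>The Loewner order; the difference is required to be symmetric, not merely
  to have a (semi)definite quadratic form.\<close>

definition loewner_le :: "real^'n^'n \<Rightarrow> real^'n^'n \<Rightarrow> bool" (infix "\<preceq>\<^sub>L" 50) where
  "M \<preceq>\<^sub>L N \<longleftrightarrow> symmetric_matrix (N - M) \<and> (\<forall>x. 0 \<le> x \<bullet> ((N - M) *v x))"

definition loewner_less :: "real^'n^'n \<Rightarrow> real^'n^'n \<Rightarrow> bool" (infix "\<prec>\<^sub>L" 50) where
  "M \<prec>\<^sub>L N \<longleftrightarrow> symmetric_matrix (N - M) \<and> (\<forall>x. x \<noteq> 0 \<longrightarrow> 0 < x \<bullet> ((N - M) *v x))"

definition block_matrix ::
  "'a^'p^'m \<Rightarrow> 'a^'q^'m \<Rightarrow> 'a^'p^'l \<Rightarrow> 'a^'q^'l \<Rightarrow> 'a^('p + 'q)^('m + 'l)" where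
  "block_matrix A B C D =
    (\<chi> i j. case i of
        Inl a \<Rightarrow> (case j of Inl b \<Rightarrow> A $ a $ b | Inr b \<Rightarrow> B $ a $ b)
      | Inr a \<Rightarrow> (case j of Inl b \<Rightarrow> C $ a $ b | Inr b \<Rightarrow> D $ a $ b))"

definition is_moore_penrose :: "real^'n^'m \<Rightarrow> real^'m^'n \<Rightarrow> bool" where
  "is_moore_penrose M X \<longleftrightarrow>
     M ** X ** M = M \<and> X ** M ** X = X \<and>
     symmetric_matrix (M ** X) \<and> symmetric_matrix (X ** M)"

definition pinv :: "real^'n^'m \<Rightarrow> real^'m^'n" where
  "pinv M = (THE X. is_moore_penrose M X)"

definition quad_map :: "('n \<Rightarrow> real^'n^'n) \<Rightarrow> real^'n \<Rightarrow> real^'n" where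
  "quad_map Q x = (\<chi> i. x \<bullet> (Q i *v x))"

definition d_vec :: "real^'n \<Rightarrow> real^'n^'n \<Rightarrow> ('n \<Rightarrow> real^'n^'n) \<Rightarrow> real^'n \<Rightarrow> real^'n" where
  "d_vec c L Q m = c + L *v m + quad_map Q m"

definition A_sym :: "real^'n^'n \<Rightarrow> ('n \<Rightarrow> real^'n^'n) \<Rightarrow> real^'n \<Rightarrow> real^'n^'n" where
  "A_sym L Q m = (1/2) *\<^sub>R (L + transpose L) - (\<Sum>k\<in>UNIV. (m $ k) *\<^sub>R Q k)"

definition primal_feasible :: "real^'n \<Rightarrow> real^'n^'n \<Rightarrow> real^'n \<Rightarrow> bool" where
  "primal_feasible d A y \<longleftrightarrow> 0 \<le> d \<bullet> y + y \<bullet> (A *v y)"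

text \<open>The real supremum below is a genuine one when \<open>A\<close> is negative definite,
  as the feasible set is then bounded (and contains 0).\<close>

definition primal_value :: "real^'n \<Rightarrow> real^'n^'n \<Rightarrow> real" where
  "primal_value d A = (SUP y\<in>{y. primal_feasible d A y}. y \<bullet> y)"

definition primal_optima :: "real^'n \<Rightarrow> real^'n^'n \<Rightarrow> (real^'n) set" where
  "primal_optima d A = {y. is_arg_max (\<lambda>y. y \<bullet> y) (primal_feasible d A) y}"

definition dual_feasible :: "real^'n \<Rightarrow> real^'n^'n \<Rightarrow> real \<times> real \<Rightarrow> bool" where
  "dual_feasible d A = (\<lambda>(lam, gam). 0 \<le> lam \<and>
     block_matrix (mat 1 + lam *\<^sub>R A) (columnvector ((lam / 2) *\<^sub>R d) :: real^1^'n)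
                  (rowvector ((lam / 2) *\<^sub>R d) :: real^'n^1) (mat (- gam) :: real^1^1) \<preceq>\<^sub>L 0)"

definition dual_optimal :: "real^'n \<Rightarrow> real^'n^'n \<Rightarrow> real \<Rightarrow> real \<Rightarrow> bool" where
  "dual_optimal d A lam gam \<longleftrightarrow> is_arg_min snd (dual_feasible d A) (lam, gam)"

text \<open>A real matrix with \<open>k\<close> columns, where \<open>k\<close> may be 0, is given by its columns
  \<open>V 0, \<dots>, V (k - 1)\<close>, and a vector of length \<open>k\<close> by its entries \<open>w 0, \<dots>, w (k - 1)\<close>;
  values at indices from \<open>k\<close> on are ignored. The Euclidean norm of such a vector is
  \<open>L2_set w {..<k}\<close>.\<close>

definition cols_mult :: "nat \<Rightarrow> (nat \<Rightarrow> real^'n) \<Rightarrow> (nat \<Rightarrow> real) \<Rightarrow> real^'n" where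
  "cols_mult k V w = (\<Sum>j<k. w j *\<^sub>R V j)"

definition orthonormal_cols :: "nat \<Rightarrow> (nat \<Rightarrow> real^'n) \<Rightarrow> bool" where
  "orthonormal_cols k V \<longleftrightarrow> (\<forall>i<k. \<forall>j<k. V i \<bullet> V j = (if i = j then 1 else 0))"

text \<open>Hypersphere with centre \<open>p\<close> in an affine subspace \<open>W\<close> of dimension \<open>k\<close>.\<close>

definition is_hypersphere_in :: "nat \<Rightarrow> (real^'n) set \<Rightarrow> real^'n \<Rightarrow> (real^'n) set \<Rightarrow> bool" where
  "is_hypersphere_in k W p S \<longleftrightarrow>
     affine W \<and> aff_dim W = int k \<and> p \<in> W \<and> (\<exists>\<rho>\<ge>0. S = {y \<in> W. dist p y = \<rho>})"

end

theory Submission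
  imports Defs
begin

text \<open>
  With \<open>A\<close> negative definite, the problem is to maximise \<open>y \<bullet> y\<close> over the solid ellipsoid
  \<open>g y \<ge> 0\<close>, where \<open>g y = d \<bullet> y + y \<bullet> (A *v y)\<close>.  Write
  \<open>M = mat 1 + lam *\<^sub>R A\<close>, so that the Lagrangian \<open>y \<bullet> y + lam * g y\<close> equals
  \<open>y \<bullet> (M *v y) + lam * (d \<bullet> y)\<close>.

  The crux is strong duality, although the problem is not convex.  By compactness an optimal
  \<open>y\<close> exists, and it lies on the boundary.  A line \<open>y + t *\<^sub>R u\<close> that is not tangent there
  meets the ellipsoid's boundary in exactly one further point, whose norm is at most that of \<open>y\<close>.
  Spelling out this inequality for all \<open>u\<close> gives everything at once: \<open>2 *\<^sub>R y\<close> is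
  \<open>- lam\<close> times the gradient of \<open>g\<close> at \<open>y\<close> for some \<open>lam > 0\<close>, and for this
  \<open>lam\<close> the matrix \<open>M\<close> is negative semidefinite (lemma \<open>primal_optimum_multiplier\<close>).
  Hence \<open>y\<close> maximises the concave Lagrangian, and \<open>(lam, y \<bullet> y)\<close> is dual feasible.

  So for any dual optimum \<open>(lam, gam)\<close> one has \<open>gam = R\<^sup>2\<close>, and complementary slackness
  identifies the primal optima as the points with \<open>y \<bullet> y = R\<^sup>2\<close> at which the Lagrangian for
  \<open>lam\<close> is maximal (lemma \<open>primal_optima_eq\<close>), that is, as the solutions with \<open>y \<bullet> y = R\<^sup>2\<close> of
  the linear system \<open>M *v y = - (lam / 2) *\<^sub>R d\<close>.  The pseudoinverse gives the solution \<open>p\<close> of this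
  system that is orthogonal to the kernel of \<open>M\<close>; all others are \<open>p + v\<close> with \<open>v\<close> in the
  kernel, and Pythagoras turns \<open>y \<bullet> y = R\<^sup>2\<close> into a condition on the norm of \<open>v\<close>.
\<close>

section \<open>Symmetric quadratic forms\<close>

lemma inner_symmetric_matrix:
  fixes M :: "real^'n^'n"
  assumes "symmetric_matrix M"
  shows "x \<bullet> (M *v y) = (M *v x) \<bullet> y"
  using assms dot_lmul_matrix[of x M y] transpose_matrix_vector[of M x]
  unfolding symmetric_matrix_def by simp

lemma quadratic_form_add:
  fixes M :: "real^'n^'n"
  assumes "symmetric_matrix M"
  shows "(y + h) \<bullet> (M *v (y + h)) = y \<bullet> (M *v y) + 2 * (h \<bullet> (M *v y)) + h \<bullet> (M *v h)"
  using inner_symmetric_matrix[OF assms, of y h]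
  by (simp add: matrix_vector_right_distrib inner_add_left inner_add_right inner_commute)

lemma symmetric_mat_1_plus_scaleR:
  fixes A :: "real^'n^'n"
  assumes "symmetric_matrix A"
  shows "symmetric_matrix (mat 1 + lam *\<^sub>R A)"
  using assms unfolding symmetric_matrix_def transpose_def mat_def
  by (auto simp: vec_eq_iff)

lemma mat_1_plus_scaleR_mult:
  fixes A :: "real^'n^'n"
  shows "(mat 1 + lam *\<^sub>R A) *v y = y + lam *\<^sub>R (A *v y)"
  by (simp add: matrix_vector_mult_add_rdistrib scaleR_matrix_vector_assoc)

lemma loewner_less_0D:
  fixes A :: "real^'n^'n"
  assumes "A \<prec>\<^sub>L 0"
  shows "symmetric_matrix A" and "\<And>x. x \<noteq> 0 \<Longrightarrow> x \<bullet> (A *v x) < 0"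
proof -
  show "symmetric_matrix A"
    using assms unfolding loewner_less_def symmetric_matrix_def transpose_def
    by (simp add: vec_eq_iff)
  have neg: "- A *v x = - (A *v x)" for x
    by (simp add: matrix_vector_mult_def vec_eq_iff sum_negf)
  show "x \<bullet> (A *v x) < 0" if "x \<noteq> 0" for x
    using assms that unfolding loewner_less_def by (simp add: neg)
qed

lemma quadratic_le_0_imp_const_le_0:
  fixes a b c :: real
  assumes "\<And>t. 0 < t \<Longrightarrow> a + t * b + t\<^sup>2 * c \<le> 0"
  shows "a \<le> 0"
proof (rule tendsto_upperbound)
  show "((\<lambda>t. a + t * b + t\<^sup>2 * c) \<longlongrightarrow> a) (at_right 0)"
    by (auto intro!: tendsto_eq_intros)
  show "\<forall>\<^sub>F t in at_right 0. a + t * b + t\<^sup>2 * c \<le> 0"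
    using assms by (auto simp: eventually_at_right_field intro: exI[of _ 1])
qed simp

text \<open>At a global maximum of the quadratic function the first variation in every direction
  vanishes; it suffices to move along the gradient.\<close>

lemma quadratic_max_stationary:
  fixes M :: "real^'n^'n" and b y :: "real^'n"
  assumes sym: "symmetric_matrix M"
    and max: "\<And>z. z \<bullet> (M *v z) + b \<bullet> z \<le> y \<bullet> (M *v y) + b \<bullet> y"
  shows "M *v y = - (1 / 2) *\<^sub>R b"
proof -
  define e where "e = 2 *\<^sub>R (M *v y) + b"
  have "e \<bullet> e + t * (e \<bullet> (M *v e)) + t\<^sup>2 * 0 \<le> 0" if "0 < t" for t
  proof -
    have "t * (e \<bullet> e + t * (e \<bullet> (M *v e))) \<le> 0"
      using max[of "y + t *\<^sub>R e"] quadratic_form_add[OF sym, of y "t *\<^sub>R e"]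
      by (simp add: e_def matrix_vector_mult_scaleR inner_add_right inner_add_left
          inner_commute algebra_simps)
    then show ?thesis using that by (simp add: mult_le_0_iff)
  qed
  then have "e \<bullet> e \<le> 0" by (rule quadratic_le_0_imp_const_le_0)
  then have "e = 0" by (metis inner_eq_zero_iff inner_ge_zero order_antisym)
  then have "2 *\<^sub>R (M *v y) + b = 0" by (simp add: e_def)
  then have "2 *\<^sub>R (M *v y) = - b" by (simp add: eq_neg_iff_add_eq_0)
  then have "(1/2) *\<^sub>R (2 *\<^sub>R (M *v y)) = (1/2) *\<^sub>R (- b)" by (rule arg_cong)
  then show ?thesis by simp
qed

text \<open>The converse for a concave quadratic function.\<close>

lemma quadratic_stationary_max:
  fixes M :: "real^'n^'n" and b y :: "real^'n"
  assumes sym: "symmetric_matrix M" and nonpos: "\<And>u. u \<bullet> (M *v u) \<le> 0"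
    and stat: "M *v y = - (1 / 2) *\<^sub>R b"
  shows "z \<bullet> (M *v z) + b \<bullet> z \<le> y \<bullet> (M *v y) + b \<bullet> y"
proof -
  define h where "h = z - y"
  then have z: "z = y + h" by simp
  show ?thesis
    unfolding z quadratic_form_add[OF sym] using nonpos[of h]
    by (simp add: stat inner_add_right inner_commute)
qed


section \<open>The dual constraint as a bound on the Lagrangian\<close>

lemma inner_block_matrix:
  fixes A :: "real^'n^'n" and b x :: "real^'n" and g t :: real
  shows "(\<chi> i. case i of Inl a \<Rightarrow> x $ a | Inr _ \<Rightarrow> t) \<bullet>
      (block_matrix A (columnvector b :: real^1^'n) (rowvector b :: real^'n^1)
        (mat g :: real^1^1) *v (\<chi> i. case i of Inl a \<Rightarrow> x $ a | Inr _ \<Rightarrow> t))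
    = x \<bullet> (A *v x) + 2 * t * (b \<bullet> x) + g * t\<^sup>2"
  by (simp add: inner_vec_def matrix_vector_mult_def block_matrix_def columnvector_def
      rowvector_def mat_def UNIV_Plus_UNIV[symmetric] sum.Plus sum.distrib sum_distrib_left
      algebra_simps power2_eq_square del: UNIV_Plus_UNIV)

text \<open>The vectors \<open>(x, t)\<close> that test semidefiniteness of the block matrix reduce, by
  homogeneity, to those with \<open>t = 1\<close>, which express the bound on the Lagrangian, and those with
  \<open>t = 0\<close>.\<close>

lemma dual_feasible_iff:
  fixes A :: "real^'n^'n" and d :: "real^'n"
  assumes sym: "symmetric_matrix A"
  defines "M \<equiv> \<lambda>lam. mat 1 + lam *\<^sub>R A"
  shows "dual_feasible d A (lam, gam) \<longleftrightarrow> 0 \<le> lam \<and> (\<forall>u. u \<bullet> (M lam *v u) \<le> 0) \<and>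
    (\<forall>y. y \<bullet> (M lam *v y) + lam * (d \<bullet> y) \<le> gam)"
    (is "?D \<longleftrightarrow> ?R")
proof -
  define B :: "real^('n + 1)^('n + 1)" where "B = block_matrix (M lam)
    (columnvector ((lam / 2) *\<^sub>R d)) (rowvector ((lam / 2) *\<^sub>R d)) (mat (- gam) :: real^1^1)"
  define q where "q x t = x \<bullet> (M lam *v x) + t * (lam * (d \<bullet> x)) - gam * t\<^sup>2" for x t
  have "transpose (M lam) = M lam"
    using symmetric_mat_1_plus_scaleR[OF sym, of lam] by (simp only: M_def symmetric_matrix_def)
  then have "transpose (M lam) $ i $ j = M lam $ i $ j" for i j by (simp only:)
  then have symM: "M lam $ j $ i = M lam $ i $ j" for i j by (simp only: transpose_def vec_lambda_beta)
  have symB: "symmetric_matrix (0 - B)"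
    using symM unfolding symmetric_matrix_def transpose_def B_def
    by (auto simp: vec_eq_iff block_matrix_def columnvector_def rowvector_def mat_def
        split: sum.splits)
  have neg: "(0 - B) *v z = - (B *v z)" for z
    by (simp add: matrix_vector_mult_def vec_eq_iff sum_negf)
  have form: "(\<chi> i. case i of Inl a \<Rightarrow> x $ a | Inr _ \<Rightarrow> t) \<bullet>
      (B *v (\<chi> i. case i of Inl a \<Rightarrow> x $ a | Inr _ \<Rightarrow> t)) = q x t" for x t
    unfolding B_def inner_block_matrix q_def by simp
  have split: "\<exists>x t. z = (\<chi> i. case i of Inl a \<Rightarrow> x $ a | Inr _ \<Rightarrow> t)" for z :: "real^('n + 1)"
    by (intro exI[of _ "\<chi> a. z $ Inl a"] exI[of _ "z $ Inr 1"])
       (auto simp: vec_eq_iff split: sum.splits intro: arg_cong)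
  have "(\<forall>z. 0 \<le> z \<bullet> ((0 - B) *v z)) \<longleftrightarrow> (\<forall>x t. q x t \<le> 0)"
    using form split unfolding neg inner_minus_right neg_0_le_iff_le by metis
  then have D: "?D \<longleftrightarrow> 0 \<le> lam \<and> (\<forall>x t. q x t \<le> 0)"
    using symB unfolding dual_feasible_def loewner_le_def B_def M_def by simp
  show ?thesis
  proof
    assume ?D
    then have "0 \<le> lam" "\<And>x. q x 0 \<le> 0" "\<And>x. q x 1 \<le> 0" using D by auto
    then show ?R by (auto simp: q_def)
  next
    assume R: ?R
    have "q x t \<le> 0" for x t
    proof (cases "t = 0")
      case True then show ?thesis using R by (simp add: q_def)
    next
      case False
      then have "q x t = t\<^sup>2 * q ((1/t) *\<^sub>R x) 1"
        by (simp add: q_def matrix_vector_mult_scaleR field_simps power2_eq_square)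
      also have "\<dots> \<le> 0"
      proof (rule mult_nonneg_nonpos)
        show "q ((1/t) *\<^sub>R x) 1 \<le> 0"
          using R[THEN conjunct2, THEN conjunct2, rule_format, of "(1/t) *\<^sub>R x"]
          unfolding q_def by simp
      qed simp
      finally show ?thesis .
    qed
    then show ?D using D R by blast
  qed
qed


section \<open>Strong duality\<close>

lemma primal_optima_iff:
  "y \<in> primal_optima d A \<longleftrightarrow>
    primal_feasible d A y \<and> (\<forall>z. primal_feasible d A z \<longrightarrow> z \<bullet> z \<le> y \<bullet> y)"
  by (auto simp: primal_optima_def is_arg_max_linorder)

lemma primal_value_optimum:
  assumes "y \<in> primal_optima d A"
  shows "primal_value d A = y \<bullet> y"
  unfolding primal_value_def using assms
  by (intro cSup_eq_maximum) (auto simp: primal_optima_iff)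

lemma compact_primal_feasible:
  fixes A :: "real^'n^'n" and d :: "real^'n"
  assumes "A \<prec>\<^sub>L 0"
  shows "compact {y. primal_feasible d A y}"
proof -
  have cont: "continuous_on S (\<lambda>y. y \<bullet> (A *v y))" for S
    by (intro continuous_intros linear_continuous_on_compose matrix_vector_mul_linear)
  have "closed {y. 0 \<le> d \<bullet> y + y \<bullet> (A *v y)}"
    by (intro closed_Collect_le continuous_intros cont)
  moreover
  obtain a where a: "a < 0" "\<And>y. y \<bullet> (A *v y) \<le> a * (norm y)\<^sup>2"
  proof -
    obtain s where s: "s \<in> sphere 0 1"
      "\<And>z. z \<in> sphere 0 1 \<Longrightarrow> z \<bullet> (A *v z) \<le> s \<bullet> (A *v s)"
      using continuous_attains_sup[OF _ _ cont, of "sphere (0 :: real^'n) 1"] by auto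
    show thesis
    proof
      show "s \<bullet> (A *v s) < 0" using s(1) by (intro loewner_less_0D(2)[OF assms]) auto
      show "y \<bullet> (A *v y) \<le> (s \<bullet> (A *v s)) * (norm y)\<^sup>2" for y
      proof (cases "y = 0")
        case False
        define z where "z = (1 / norm y) *\<^sub>R y"
        have y: "y = norm y *\<^sub>R z" and "z \<in> sphere 0 1" using False by (auto simp: z_def)
        have "y \<bullet> (A *v y) = (z \<bullet> (A *v z)) * (norm y)\<^sup>2"
          by (subst (1 2) y) (simp add: matrix_vector_mult_scaleR power2_eq_square)
        then show ?thesis
          using s(2)[OF \<open>z \<in> sphere 0 1\<close>] by (simp add: mult_right_mono)
      qed simp
    qed
  qed
  have "norm y \<le> norm d / - a" if "0 \<le> d \<bullet> y + y \<bullet> (A *v y)" for y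
  proof (cases "y = 0")
    case False
    have "0 \<le> norm d * norm y + a * (norm y)\<^sup>2"
      using that a(2)[of y] norm_cauchy_schwarz[of d y] by linarith
    then have "0 \<le> norm y * (norm d + a * norm y)"
      by (simp add: power2_eq_square algebra_simps)
    then have "0 \<le> norm d + a * norm y" using False by (simp add: zero_le_mult_iff)
    then show ?thesis using a(1) by (simp add: field_simps)
  qed (use a(1) in \<open>simp add: divide_nonneg_nonpos\<close>)
  then have "bounded {y. 0 \<le> d \<bullet> y + y \<bullet> (A *v y)}" by (auto simp: bounded_iff)
  ultimately show ?thesis
    unfolding primal_feasible_def compact_eq_bounded_closed by blast
qed

lemma primal_optima_nonempty:
  fixes A :: "real^'n^'n" and d :: "real^'n"
  assumes "A \<prec>\<^sub>L 0"
  obtains y where "y \<in> primal_optima d A"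
proof -
  have "{y. primal_feasible d A y} \<noteq> {}"
    by (auto simp: primal_feasible_def intro: exI[of _ 0])
  moreover have "continuous_on {y. primal_feasible d A y} (\<lambda>y. y \<bullet> y)"
    by (intro continuous_intros)
  ultimately obtain y where "primal_feasible d A y"
    "\<And>z. primal_feasible d A z \<Longrightarrow> z \<bullet> z \<le> y \<bullet> y"
    using continuous_attains_sup[OF compact_primal_feasible[OF assms, of d]] by blast
  then show thesis by (intro that[of y]) (simp add: primal_optima_iff)
qed

text \<open>If the constraint were slack, moving \<open>y\<close> slightly away from the origin would preserve
  feasibility and increase the norm.\<close>

lemma primal_optimum_active:
  fixes A :: "real^'n^'n" and d :: "real^'n"
  assumes opt: "y \<in> primal_optima d A"
  shows "d \<bullet> y + y \<bullet> (A *v y) = 0"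
proof -
  define a b where "a = d \<bullet> y" and "b = y \<bullet> (A *v y)"
  have "0 \<le> a + b" using opt by (simp add: primal_optima_iff primal_feasible_def a_def b_def)
  moreover have "a + b \<le> 0"
  proof (cases "y = 0")
    case True then show ?thesis by (simp add: a_def b_def)
  next
    case False
    show ?thesis
    proof (rule quadratic_le_0_imp_const_le_0)
      fix t :: real assume t: "0 < t"
      define z where "z = (1 + t) *\<^sub>R y"
      have "y \<bullet> y < (1 + t)\<^sup>2 * (y \<bullet> y)" using False t by (simp add: one_less_power)
      then have "y \<bullet> y < z \<bullet> z" by (simp add: z_def power2_eq_square)
      then have "\<not> primal_feasible d A z" using opt by (auto simp: primal_optima_iff not_le)
      then have "(1 + t) * a + (1 + t)\<^sup>2 * b < 0"
        by (simp add: primal_feasible_def z_def a_def b_def matrix_vector_mult_scaleR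
            power2_eq_square)
      then show "(a + b) + t * (a + 2 * b) + t\<^sup>2 * b \<le> 0"
        by (simp add: algebra_simps power2_eq_square)
    qed
  qed
  ultimately show ?thesis by (simp add: a_def b_def)
qed

text \<open>With \<open>e\<close> the gradient of the constraint at \<open>y\<close>, the line \<open>y + t *\<^sub>R u\<close> leaves the
  ellipsoid again at \<open>t = (e \<bullet> u) / - (u \<bullet> (A *v u))\<close>; the claim compares the norm of that point
  with the norm of \<open>y\<close>.\<close>

lemma primal_optimum_chord:
  fixes A :: "real^'n^'n" and d y u :: "real^'n"
  assumes A: "A \<prec>\<^sub>L 0" and opt: "y \<in> primal_optima d A"
  defines "e \<equiv> d + 2 *\<^sub>R (A *v y)"
  assumes u: "0 < e \<bullet> u"
  shows "(e \<bullet> u) * (u \<bullet> u) \<le> 2 * (y \<bullet> u) * (u \<bullet> (A *v u))"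
proof -
  define b where "b = - (u \<bullet> (A *v u))"
  have "u \<noteq> 0" using u by auto
  then have b: "0 < b" using loewner_less_0D(2)[OF A] by (simp add: b_def)
  define t where "t = (e \<bullet> u) / b"
  have t: "0 < t" using u b by (simp add: t_def)
  have "t * (e \<bullet> u) - t\<^sup>2 * b = 0" using b by (simp add: t_def power2_eq_square)
  then have "d \<bullet> (y + t *\<^sub>R u) + (y + t *\<^sub>R u) \<bullet> (A *v (y + t *\<^sub>R u)) = 0"
    unfolding quadratic_form_add[OF loewner_less_0D(1)[OF A]]
    using primal_optimum_active[OF opt]
    by (simp add: e_def b_def matrix_vector_mult_scaleR inner_add_right inner_add_left
        inner_commute algebra_simps power2_eq_square)
  then have "primal_feasible d A (y + t *\<^sub>R u)" by (simp add: primal_feasible_def)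
  then have "(y + t *\<^sub>R u) \<bullet> (y + t *\<^sub>R u) \<le> y \<bullet> y" using opt by (simp add: primal_optima_iff)
  then have "t * (2 * (y \<bullet> u) + t * (u \<bullet> u)) \<le> 0"
    by (simp add: inner_add_left inner_add_right inner_commute algebra_simps)
  then have "2 * (y \<bullet> u) + t * (u \<bullet> u) \<le> 0" using t by (simp add: mult_le_0_iff)
  then have "b * (2 * (y \<bullet> u) + t * (u \<bullet> u)) \<le> 0" using b by (simp add: mult_le_0_iff)
  then have "2 * (y \<bullet> u) * b + (e \<bullet> u) * (u \<bullet> u) \<le> 0" using b by (simp add: t_def algebra_simps)
  then show ?thesis by (simp add: b_def)
qed

text \<open>The chord inequality says first that \<open>y \<bullet> u\<close> is negative whenever \<open>e \<bullet> u\<close> is positive, which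
  forces \<open>y\<close> to be a negative multiple of \<open>e\<close>; dividing it by \<open>e \<bullet> u\<close> then yields
  the second-order condition, first for \<open>u\<close> not orthogonal to \<open>e\<close> and, in the limit, for all
  \<open>u\<close>.\<close>

lemma primal_optimum_multiplier:
  fixes A :: "real^'n^'n" and d :: "real^'n"
  assumes A: "A \<prec>\<^sub>L 0" and d: "d \<noteq> 0" and opt: "y \<in> primal_optima d A"
  obtains lam where "0 < lam"
    "(mat 1 + lam *\<^sub>R A) *v y = - (1 / 2) *\<^sub>R (lam *\<^sub>R d)"
    "\<And>u. u \<bullet> ((mat 1 + lam *\<^sub>R A) *v u) \<le> 0"
proof -
  define e where "e = d + 2 *\<^sub>R (A *v y)"
  have chord: "(e \<bullet> u) * (u \<bullet> u) \<le> 2 * (y \<bullet> u) * (u \<bullet> (A *v u))" if "0 < e \<bullet> u" for u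
    using primal_optimum_chord[OF A opt] that unfolding e_def by blast
  have "e \<noteq> 0"
  proof
    assume e: "e = 0"
    then have "(d + 2 *\<^sub>R (A *v y)) \<bullet> y = 0" by (simp add: e_def)
    then have "d \<bullet> y + 2 * (y \<bullet> (A *v y)) = 0"
      by (simp only: inner_add_left inner_scaleR_left inner_commute[of "A *v y"])
    then have "y \<bullet> (A *v y) = 0" using primal_optimum_active[OF opt] by simp
    then have "y = 0" using loewner_less_0D(2)[OF A, of y] by force
    then show False using e d by (simp add: e_def)
  qed
  then have ee: "0 < e \<bullet> e" by simp
  have neg: "y \<bullet> u < 0" if "0 < e \<bullet> u" for u
  proof -
    have "u \<noteq> 0" using that by auto
    then have "0 < (e \<bullet> u) * (u \<bullet> u)" "u \<bullet> (A *v u) < 0"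
      using that loewner_less_0D(2)[OF A] by auto
    then show ?thesis using chord[OF that]
      by (smt (verit) mult_nonneg_nonpos)
  qed
  have orth: "y \<bullet> u \<le> 0" if "e \<bullet> u = 0" for u
  proof (rule quadratic_le_0_imp_const_le_0)
    fix t :: real assume "0 < t"
    then have "y \<bullet> (u + t *\<^sub>R e) < 0" using that ee by (intro neg) (simp add: inner_add_right)
    then show "y \<bullet> u + t * (y \<bullet> e) + t\<^sup>2 * 0 \<le> 0" by (simp add: inner_add_right)
  qed
  \<comment> \<open>The component of \<open>y\<close> orthogonal to \<open>e\<close> is \<open>y + mu *\<^sub>R e\<close>; testing \<open>orth\<close> with it
    shows that it vanishes.\<close>
  define mu where "mu = - (y \<bullet> e) / (e \<bullet> e)"
  have mu: "0 < mu" unfolding mu_def using neg[OF ee] ee by (intro divide_pos_pos) auto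
  have "e \<bullet> (y + mu *\<^sub>R e) = 0" using ee
    by (simp only: mu_def inner_add_right inner_scaleR_right inner_commute[of y]) simp
  then have "(y + mu *\<^sub>R e) \<bullet> (y + mu *\<^sub>R e) \<le> 0"
    using orth[of "y + mu *\<^sub>R e"] by (simp add: inner_add_left)
  then have "y + mu *\<^sub>R e = 0" by (metis inner_eq_zero_iff inner_ge_zero order_antisym)
  then have y: "y = - mu *\<^sub>R e" by (simp add: eq_neg_iff_add_eq_0)
  define lam where "lam = 2 * mu"
  define N where "N = mat 1 + lam *\<^sub>R A"
  have second: "u \<bullet> (N *v u) \<le> 0" if "0 < e \<bullet> u" for u
  proof -
    have "(e \<bullet> u) * (u \<bullet> u + lam * (u \<bullet> (A *v u))) \<le> 0"
      using chord[OF that] arg_cong[OF y, of "\<lambda>v. v \<bullet> u"]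
      by (simp add: lam_def algebra_simps)
    then show ?thesis using that
      by (simp add: mult_le_0_iff N_def mat_1_plus_scaleR_mult inner_add_right)
  qed
  have symM: "symmetric_matrix N"
    unfolding N_def using loewner_less_0D(1)[OF A] by (rule symmetric_mat_1_plus_scaleR)
  have second': "u \<bullet> (N *v u) \<le> 0" if "0 \<le> e \<bullet> u" for u
  proof (rule quadratic_le_0_imp_const_le_0)
    fix t :: real assume "0 < t"
    then have "0 < e \<bullet> (u + t *\<^sub>R e)" using that ee by (simp add: inner_add_right add_nonneg_pos)
    from second[OF this, unfolded quadratic_form_add[OF symM]]
    show "u \<bullet> (N *v u) + t * (2 * (e \<bullet> (N *v u)))
        + t\<^sup>2 * (e \<bullet> (N *v e)) \<le> 0"
      by (simp add: matrix_vector_mult_scaleR power2_eq_square algebra_simps)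
  qed
  show thesis
  proof
    show "0 < lam" using mu by (simp add: lam_def)
    have "y + lam *\<^sub>R (A *v y) = - mu *\<^sub>R d"
      using \<open>y + mu *\<^sub>R e = 0\<close> by (simp add: e_def lam_def algebra_simps eq_neg_iff_add_eq_0)
    then show "(mat 1 + lam *\<^sub>R A) *v y = - (1 / 2) *\<^sub>R (lam *\<^sub>R d)"
      by (simp add: mat_1_plus_scaleR_mult lam_def)
    show "u \<bullet> ((mat 1 + lam *\<^sub>R A) *v u) \<le> 0" for u
    proof (cases "0 \<le> e \<bullet> u")
      case True then show ?thesis by (rule second'[unfolded N_def])
    next
      case False
      have "- u = (- 1) *\<^sub>R u" by simp
      then have "(mat 1 + lam *\<^sub>R A) *v (- u) = - ((mat 1 + lam *\<^sub>R A) *v u)"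
        by (metis matrix_vector_mult_scaleR scaleR_minus1_left)
      then show ?thesis using second'[of "- u", unfolded N_def] False by simp
    qed
  qed
qed

lemma lagrangian_eq:
  fixes A :: "real^'n^'n"
  shows "y \<bullet> ((mat 1 + lam *\<^sub>R A) *v y) + lam * (d \<bullet> y) = y \<bullet> y + lam * (d \<bullet> y + y \<bullet> (A *v y))"
  unfolding mat_1_plus_scaleR_mult by (simp add: inner_add_right algebra_simps)

text \<open>With the multiplier \<open>l\<close> of a primal optimum \<open>y\<close>, the pair \<open>(l, y \<bullet> y)\<close> is dual
  feasible, which bounds the dual optimum from above; the Lagrangian at \<open>y\<close> bounds it from
  below.\<close>

lemma strong_duality:
  fixes A :: "real^'n^'n" and d :: "real^'n"
  assumes A: "A \<prec>\<^sub>L 0" and d: "d \<noteq> 0" and dual: "dual_optimal d A lam gam"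
  shows "gam = primal_value d A"
proof -
  note feas = dual_feasible_iff[OF loewner_less_0D(1)[OF A]]
  obtain y where y: "y \<in> primal_optima d A" by (rule primal_optima_nonempty[OF A])
  obtain l where l: "0 < l" "(mat 1 + l *\<^sub>R A) *v y = - (1 / 2) *\<^sub>R (l *\<^sub>R d)"
    "\<And>u. u \<bullet> ((mat 1 + l *\<^sub>R A) *v u) \<le> 0"
    by (rule primal_optimum_multiplier[OF A d y]) blast
  have "z \<bullet> ((mat 1 + l *\<^sub>R A) *v z) + l * (d \<bullet> z) \<le> y \<bullet> y" for z
    using quadratic_stationary_max[OF symmetric_mat_1_plus_scaleR[OF loewner_less_0D(1)[OF A]] l(3,2), of z]
      lagrangian_eq[of y l A d] primal_optimum_active[OF y]
    by simp
  then have "dual_feasible d A (l, y \<bullet> y)" using l by (simp add: feas)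
  then have "gam \<le> y \<bullet> y" using dual by (force simp: dual_optimal_def is_arg_min_linorder)
  moreover have "y \<bullet> y \<le> gam"
    using dual lagrangian_eq[of y lam A d] primal_optimum_active[OF y]
    by (auto simp: dual_optimal_def is_arg_min_linorder feas dest: spec[of _ y])
  ultimately show ?thesis using primal_value_optimum[OF y] by simp
qed

text \<open>Complementary slackness.  Feasibility of \<open>y\<close> is read off from the value of the Lagrangian at
  \<open>y\<close>, which requires \<open>lam > 0\<close>; this holds because \<open>lam = 0\<close> makes \<open>M\<close> the identity,
  which is not negative semidefinite.\<close>

lemma primal_optima_eq:
  fixes A :: "real^'n^'n" and d :: "real^'n"
  assumes A: "A \<prec>\<^sub>L 0" and d: "d \<noteq> 0" and dual: "dual_optimal d A lam gam"
  shows "primal_optima d A = {y. y \<bullet> y = primal_value d A \<and>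
           (mat 1 + lam *\<^sub>R A) *v y = - (lam / 2) *\<^sub>R d}"
proof -
  let ?M = "mat 1 + lam *\<^sub>R A"
  define Lg where "Lg y = y \<bullet> (?M *v y) + lam * (d \<bullet> y)" for y
  have symM: "symmetric_matrix ?M"
    using loewner_less_0D(1)[OF A] by (rule symmetric_mat_1_plus_scaleR)
  have nonneg: "0 \<le> lam" and nsd: "\<And>u. u \<bullet> (?M *v u) \<le> 0" and bound: "\<And>z. Lg z \<le> gam"
    using dual dual_feasible_iff[OF loewner_less_0D(1)[OF A], of d lam gam]
    by (auto simp: dual_optimal_def is_arg_min_linorder Lg_def)
  have "lam \<noteq> 0"
  proof
    assume "lam = 0"
    then have "d \<bullet> d \<le> 0" using nsd[of d] by simp
    then show False using d by (metis inner_eq_zero_iff inner_ge_zero order_antisym)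
  qed
  with nonneg have pos: "0 < lam" by simp
  have gam: "gam = primal_value d A" by (rule strong_duality[OF A d dual])
  have value_at: "Lg y = gam" if "y \<in> primal_optima d A" for y
    using lagrangian_eq[of y lam A d] primal_optimum_active[OF that]
      primal_value_optimum[OF that] gam
    by (simp add: Lg_def)
  show ?thesis
  proof (intro set_eqI iffI)
    fix y assume y: "y \<in> primal_optima d A"
    have "?M *v y = - (1 / 2) *\<^sub>R (lam *\<^sub>R d)"
      using bound value_at[OF y] by (intro quadratic_max_stationary[OF symM]) (simp add: Lg_def)
    then show "y \<in> {y. y \<bullet> y = primal_value d A \<and> ?M *v y = - (lam / 2) *\<^sub>R d}"
      using primal_value_optimum[OF y] by simp
  next
    fix y assume "y \<in> {y. y \<bullet> y = primal_value d A \<and> ?M *v y = - (lam / 2) *\<^sub>R d}"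
    then have yy: "y \<bullet> y = gam" and stat: "?M *v y = - (1 / 2) *\<^sub>R (lam *\<^sub>R d)"
      using gam by auto
    obtain z where z: "z \<in> primal_optima d A" by (rule primal_optima_nonempty[OF A])
    have "Lg z \<le> Lg y"
      using quadratic_stationary_max[OF symM nsd stat, of z] by (simp add: Lg_def)
    then have "Lg y = y \<bullet> y" using bound[of y] value_at[OF z] yy by simp
    then have "d \<bullet> y + y \<bullet> (A *v y) = 0"
      using pos lagrangian_eq[of y lam A d] by (simp add: Lg_def)
    then show "y \<in> primal_optima d A"
      using yy z primal_value_optimum[OF z] gam
      by (auto simp: primal_optima_iff primal_feasible_def)
  qed
qed


section \<open>The pseudoinverse of a symmetric matrix\<close>

text \<open>With two pseudoinverses \<open>X\<close>, \<open>Y\<close> of \<open>M\<close>, symmetry of the products gives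
  \<open>M ** X = M ** Y\<close> and \<open>X ** M = Y ** M\<close>, hence \<open>X = X ** M ** X = Y ** M ** Y = Y\<close>.\<close>

lemma moore_penrose_unique:
  fixes M :: "real^'n^'m"
  assumes X: "is_moore_penrose M X" and Y: "is_moore_penrose M Y"
  shows "X = Y"
proof -
  have "M ** X = transpose (M ** Y ** M ** X)"
    using X Y by (simp add: is_moore_penrose_def symmetric_matrix_def)
  also have "\<dots> = transpose (M ** X) ** transpose (M ** Y)"
    by (simp only: matrix_transpose_mul[symmetric] matrix_mul_assoc)
  also have "\<dots> = M ** X ** M ** Y"
    using X Y by (simp add: is_moore_penrose_def symmetric_matrix_def matrix_mul_assoc)
  also have "\<dots> = M ** Y" using X by (simp add: is_moore_penrose_def)
  finally have MX: "M ** X = M ** Y" .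
  have "X ** M = transpose (X ** (M ** Y ** M))"
    using X Y by (simp add: is_moore_penrose_def symmetric_matrix_def)
  also have "\<dots> = transpose (Y ** M) ** transpose (X ** M)"
    by (simp only: matrix_transpose_mul[symmetric] matrix_mul_assoc)
  also have "\<dots> = Y ** M ** (X ** M)"
    using X Y by (simp add: is_moore_penrose_def symmetric_matrix_def)
  also have "\<dots> = Y ** (M ** X ** M)" by (simp only: matrix_mul_assoc)
  also have "\<dots> = Y ** M" using X by (simp add: is_moore_penrose_def)
  finally have XM: "X ** M = Y ** M" .
  have "X = X ** (M ** X)" using X by (simp add: is_moore_penrose_def matrix_mul_assoc)
  also have "\<dots> = X ** M ** Y" by (simp add: MX matrix_mul_assoc)
  also have "\<dots> = Y" using Y by (simp add: XM is_moore_penrose_def)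
  finally show ?thesis .
qed

lemma orthogonal_projection_matrix:
  fixes S :: "(real^'n) set"
  assumes "subspace S"
  obtains P :: "real^'n^'n" where "symmetric_matrix P" "\<And>x. P *v x \<in> S"
    "\<And>x. x \<in> S \<Longrightarrow> P *v x = x"
proof -
  obtain B where B: "B \<subseteq> S" "pairwise orthogonal B" "\<And>x. x \<in> B \<Longrightarrow> norm x = 1"
    "independent B" "span B = S"
    by (rule orthonormal_basis_subspace[OF assms]) blast
  have fin: "finite B" using B(4) by (rule independent_imp_finite)
  define f where "f x = (\<Sum>b\<in>B. (b \<bullet> x) *\<^sub>R b)" for x
  have lin: "linear f"
    unfolding f_def
    by (intro linearI) (simp_all add: inner_add_right scaleR_add_left sum.distrib scaleR_sum_right)
  show thesis
  proof
    have fP: "matrix f *v x = f x" for x using fun_cong[OF matrix_vector_mul(2)[OF lin], of x] by simp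
    show "symmetric_matrix (matrix f)"
      by (auto simp: symmetric_matrix_def transpose_def matrix_def vec_eq_iff f_def
          inner_axis mult.commute)
    show "matrix f *v x \<in> S" for x
      unfolding fP f_def using B(1) assms by (auto intro!: subspace_sum subspace_scale)
    have "f b = b" if b: "b \<in> B" for b
    proof -
      have "f b = (\<Sum>a\<in>B. if a = b then b else 0)"
        unfolding f_def
      proof (rule sum.cong[OF refl])
        fix a assume a: "a \<in> B"
        show "(a \<bullet> b) *\<^sub>R a = (if a = b then b else 0)"
          using B(3)[OF b] pairwiseD[OF B(2) a b]
          by (auto simp: orthogonal_def dot_square_norm)
      qed
      then show ?thesis using b fin by simp
    qed
    then show "matrix f *v x = x" if "x \<in> S" for x
      using linear_eq_on_span[OF lin linear_id, of B x] that B(5) by (simp add: fP)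
  qed
qed

text \<open>Adding to \<open>M\<close> the orthogonal projection \<open>P\<close> onto its kernel makes it invertible, and
  the inverse minus \<open>P\<close> is the pseudoinverse: both products with \<open>M\<close> equal
  \<open>mat 1 - P\<close>.\<close>

lemma symmetric_moore_penrose_exists:
  fixes M :: "real^'n^'n"
  assumes sym: "symmetric_matrix M"
  obtains X where "is_moore_penrose M X"
proof -
  have ker: "subspace {x. M *v x = 0}"
    by (auto simp: subspace_def matrix_vector_right_distrib matrix_vector_mult_scaleR)
  obtain P where P: "symmetric_matrix P" "\<And>x. P *v x \<in> {x. M *v x = 0}"
    "\<And>x. x \<in> {x. M *v x = 0} \<Longrightarrow> P *v x = x"
    by (rule orthogonal_projection_matrix[OF ker]) blast
  have MP: "M ** P = 0"
    using P(2) by (simp add: matrix_eq matrix_vector_mul_assoc[symmetric])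
  have PP: "P ** P = P"
    using P(2,3) by (simp add: matrix_eq matrix_vector_mul_assoc[symmetric])
  have PM: "P ** M = 0"
  proof -
    have "P ** M = transpose (M ** P)"
      using sym P(1) by (simp add: matrix_transpose_mul symmetric_matrix_def)
    also have "\<dots> = 0" by (simp add: MP transpose_def vec_eq_iff)
    finally show ?thesis .
  qed
  define N where "N = M + P"
  have "x = 0" if "N *v x = 0" for x
  proof -
    have sum0: "M *v x + P *v x = 0" using that by (simp add: N_def matrix_vector_mult_add_rdistrib)
    have "P *v (M *v x + P *v x) = P *v x"
      by (simp add: matrix_vector_right_distrib matrix_vector_mul_assoc PM PP)
    then have "P *v x = 0" by (simp add: sum0)
    moreover from this have "M *v x = 0" using sum0 by simp
    ultimately show ?thesis using P(3)[of x] by simp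
  qed
  then obtain Z where ZN: "Z ** N = mat 1"
    using matrix_left_invertible_ker[of N] by blast
  then have NZ: "N ** Z = mat 1" using matrix_left_right_inverse by blast
  have addl: "(B + C) ** D = B ** D + C ** D" for B C D :: "real^'n^'n"
    by (simp add: matrix_matrix_mult_def vec_eq_iff sum.distrib algebra_simps)
  have ZP: "Z ** P = P"
  proof -
    have "N ** P = P" by (simp add: N_def addl PM MP PP)
    then have "Z ** P = Z ** N ** P" by (simp add: matrix_mul_assoc[symmetric])
    then show ?thesis by (simp add: ZN)
  qed
  have PZ: "P ** Z = P"
  proof -
    have "P ** N = P" by (simp add: N_def matrix_add_ldistrib PM PP)
    then have "P ** Z = P ** (N ** Z)" by (simp add: matrix_mul_assoc)
    then show ?thesis by (simp add: NZ)
  qed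
  have diffl: "(B - C) ** D = B ** D - C ** D" and diffr: "D ** (B - C) = D ** B - D ** C"
    for B C D :: "real^'n^'n"
    by (simp_all add: matrix_matrix_mult_def vec_eq_iff sum_subtractf algebra_simps)
  have M: "M = N - P" by (simp add: N_def)
  define X where "X = Z - P"
  have XM: "X ** M = mat 1 - P"
    by (simp add: X_def diffl PM) (simp add: M diffr ZN ZP)
  have MX: "M ** X = mat 1 - P"
    by (simp add: X_def diffr MP) (simp add: M diffl NZ PZ)
  have symI: "symmetric_matrix (mat 1 - P)"
    using P(1) by (auto simp: symmetric_matrix_def transpose_def vec_eq_iff mat_def)
  show thesis
  proof
    show "is_moore_penrose M X"
      unfolding is_moore_penrose_def MX XM
      using symI by (simp add: diffl PM, simp add: X_def diffr PZ PP)
  qed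
qed

lemma pinv_symmetric_matrix:
  fixes M :: "real^'n^'n"
  assumes sym: "symmetric_matrix M"
  shows "is_moore_penrose M (pinv M)" and "symmetric_matrix (pinv M)"
proof -
  obtain X where X: "is_moore_penrose M X" by (rule symmetric_moore_penrose_exists[OF sym])
  then have "pinv M = X"
    unfolding pinv_def using moore_penrose_unique by blast
  then show pinv: "is_moore_penrose M (pinv M)" using X by simp
  \<comment> \<open>Transposing the four defining equations for \<open>M\<close> gives those for \<open>transpose M = M\<close>.\<close>
  let ?X = "pinv M"
  have M: "transpose M = M" using sym by (simp add: symmetric_matrix_def)
  have MX: "M ** transpose ?X = transpose (?X ** M)" and XM: "transpose ?X ** M = transpose (M ** ?X)"
    by (simp_all only: matrix_transpose_mul M)
  have "M ** transpose ?X ** M = transpose (M ** ?X ** M)"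
    "transpose ?X ** M ** transpose ?X = transpose (?X ** M ** ?X)"
    by (simp_all only: matrix_transpose_mul M matrix_mul_assoc)
  then have 1: "M ** transpose ?X ** M = M" and 2: "transpose ?X ** M ** transpose ?X = transpose ?X"
    using pinv M by (simp_all only: is_moore_penrose_def)
  have "M ** transpose ?X = ?X ** M" "transpose ?X ** M = M ** ?X"
    using MX XM pinv by (simp_all only: is_moore_penrose_def symmetric_matrix_def)
  then have "is_moore_penrose M (transpose ?X)"
    unfolding is_moore_penrose_def using 1 2 pinv by (simp only: is_moore_penrose_def simp_thms)
  then have "transpose ?X = ?X" using pinv by (rule moore_penrose_unique)
  then show "symmetric_matrix ?X" by (simp only: symmetric_matrix_def)
qed

text \<open>\<open>pinv M *v b\<close> is the minimum norm solution of a solvable system \<open>M *v y = b\<close>.\<close>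

lemma pinv_solves:
  fixes M :: "real^'n^'n"
  assumes "symmetric_matrix M" and "M *v y = b"
  shows "M *v (pinv M *v b) = b"
  using pinv_symmetric_matrix(1)[OF assms(1)] assms(2)
  by (metis is_moore_penrose_def matrix_vector_mul_assoc)

lemma pinv_orthogonal_kernel:
  fixes M :: "real^'n^'n"
  assumes "symmetric_matrix M" and "M *v v = 0"
  shows "(pinv M *v b) \<bullet> v = 0"
proof -
  have pinv: "is_moore_penrose M (pinv M)" by (rule pinv_symmetric_matrix(1)[OF assms(1)])
  then have "(pinv M *v b) \<bullet> v = ((pinv M ** M) *v (pinv M *v b)) \<bullet> v"
    by (simp add: is_moore_penrose_def matrix_vector_mul_assoc)
  also have "\<dots> = (pinv M *v b) \<bullet> ((pinv M ** M) *v v)"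
    using pinv by (simp add: is_moore_penrose_def inner_symmetric_matrix)
  also have "\<dots> = 0" using assms(2) by (simp add: matrix_vector_mul_assoc[symmetric])
  finally show ?thesis .
qed


section \<open>Orthonormal columns\<close>

lemma inner_cols_mult:
  assumes "orthonormal_cols k V"
  shows "cols_mult k V w \<bullet> cols_mult k V w = (L2_set w {..<k})\<^sup>2"
proof -
  have "cols_mult k V w \<bullet> cols_mult k V w = (\<Sum>i<k. \<Sum>j<k. w i * w j * (V j \<bullet> V i))"
    by (simp add: cols_mult_def inner_sum_left inner_sum_right sum_distrib_left mult.assoc)
  also have "\<dots> = (\<Sum>i<k. \<Sum>j<k. if i = j then w i * w j else 0)"
    using assms by (intro sum.cong) (auto simp: orthonormal_cols_def)
  also have "\<dots> = (\<Sum>i<k. (w i)\<^sup>2)" by (simp add: power2_eq_square)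
  finally show ?thesis by (simp add: L2_set_def sum_nonneg)
qed

lemma orthonormal_cols_inj:
  assumes "orthonormal_cols k V"
  shows "inj_on V {..<k}"
proof (rule inj_onI)
  fix i j assume "i \<in> {..<k}" "j \<in> {..<k}" "V i = V j"
  then show "i = j" using assms unfolding orthonormal_cols_def
    by (metis lessThan_iff zero_neq_one)
qed

lemma span_cols_eq:
  assumes "orthonormal_cols k V"
  shows "span (V ` {..<k}) = range (cols_mult k V)"
proof (intro set_eqI iffI)
  fix x assume "x \<in> span (V ` {..<k})"
  then obtain u where "x = (\<Sum>v\<in>V ` {..<k}. u v *\<^sub>R v)" by (auto simp: span_finite)
  also have "\<dots> = cols_mult k V (u \<circ> V)"
    by (simp add: cols_mult_def sum.reindex[OF orthonormal_cols_inj[OF assms]])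
  finally show "x \<in> range (cols_mult k V)" by blast
next
  fix x assume "x \<in> range (cols_mult k V)"
  then show "x \<in> span (V ` {..<k})"
    by (auto simp: cols_mult_def intro!: span_sum span_scale intro: span_base)
qed

lemma dim_span_cols:
  assumes "orthonormal_cols k V"
  shows "dim (span (V ` {..<k})) = k"
proof -
  have "pairwise orthogonal (V ` {..<k})"
    using assms by (auto simp: pairwise_def orthogonal_def orthonormal_cols_def)
  moreover have "0 \<notin> V ` {..<k}"
    using assms unfolding orthonormal_cols_def by (metis imageE inner_zero_left lessThan_iff zero_neq_one)
  ultimately have "independent (V ` {..<k})" by (rule pairwise_orthogonal_independent)
  then show ?thesis
    using card_image[OF orthonormal_cols_inj[OF assms]] by (simp add: dim_span dim_eq_card_independent)
qed


section \<open>The set of optimal solutions\<close>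

theorem mainTheorem3:
  fixes c m d p :: "real^'n" and L A M :: "real^'n^'n" and Q :: "'n \<Rightarrow> real^'n^'n"
    and R lam gam :: real and r :: nat and V :: "nat \<Rightarrow> real^'n"
  assumes "\<And>i. symmetric_matrix (Q i)"
    and "\<And>x. x \<bullet> quad_map Q x = 0"
    and "d = d_vec c L Q m"
    and "A = A_sym L Q m"
    and "A \<prec>\<^sub>L 0"
    and "d \<noteq> 0"
    and "R\<^sup>2 = primal_value d A"
    and "dual_optimal d A lam gam"
    and "M = mat 1 + lam *\<^sub>R A"
    and "r = rank M"
    and "orthonormal_cols (CARD('n) - r) V"
    and "span (V ` {..<CARD('n) - r}) = {x. M *v x = 0}"
    and "p = - (lam / 2) *\<^sub>R (pinv M *v d)"
  shows "primal_optima d A =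
           {p + cols_mult (CARD('n) - r) V w | w.
              (L2_set w {..<CARD('n) - r})\<^sup>2 = R\<^sup>2 - lam\<^sup>2 / 4 * (d \<bullet> ((pinv M ** pinv M) *v d))}
         \<and> is_hypersphere_in (CARD('n) - r) ((+) p ` span (V ` {..<CARD('n) - r})) p
             (primal_optima d A)"
proof -
  define k where "k = CARD('n) - r"
  define K where "K = span (V ` {..<k})"
  note A = \<open>A \<prec>\<^sub>L 0\<close> and M = \<open>M = mat 1 + lam *\<^sub>R A\<close>
    and p = \<open>p = - (lam / 2) *\<^sub>R (pinv M *v d)\<close>
  have V: "orthonormal_cols k V" and ker: "K = {x. M *v x = 0}"
    using assms by (simp_all add: k_def K_def)
  have symM: "symmetric_matrix M"
    unfolding M using loewner_less_0D(1)[OF A] by (rule symmetric_mat_1_plus_scaleR)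
  have opt: "primal_optima d A = {y. y \<bullet> y = R\<^sup>2 \<and> M *v y = - (lam / 2) *\<^sub>R d}"
    using primal_optima_eq[OF A \<open>d \<noteq> 0\<close> \<open>dual_optimal d A lam gam\<close>] \<open>R\<^sup>2 = primal_value d A\<close> M by simp
  obtain y0 where y0: "y0 \<in> primal_optima d A" by (rule primal_optima_nonempty[OF A])
  have p': "p = pinv M *v (- (lam / 2) *\<^sub>R d)" by (simp only: p matrix_vector_mult_scaleR)
  have Mp: "M *v p = - (lam / 2) *\<^sub>R d"
    unfolding p' using y0 by (intro pinv_solves[OF symM, of y0]) (simp add: opt)
  have orth: "p \<bullet> v = 0" if "v \<in> K" for v
    unfolding p' using pinv_orthogonal_kernel[OF symM] that by (simp add: ker)
  have solution: "M *v y = - (lam / 2) *\<^sub>R d \<longleftrightarrow> y - p \<in> K" for y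
    unfolding ker mem_Collect_eq matrix_vector_mult_diff_distrib Mp right_minus_eq by (rule refl)
  have pythagoras: "(p + v) \<bullet> (p + v) = p \<bullet> p + v \<bullet> v" if "v \<in> K" for v
    using orth[OF that] by (simp add: inner_add_left inner_add_right inner_commute)
  have pp: "p \<bullet> p = lam\<^sup>2 / 4 * (d \<bullet> ((pinv M ** pinv M) *v d))"
    using inner_symmetric_matrix[OF pinv_symmetric_matrix(2)[OF symM], of d "pinv M *v d"]
    by (simp add: p matrix_vector_mul_assoc[symmetric] power2_eq_square)
  have opt_K: "primal_optima d A = {p + v | v. v \<in> K \<and> v \<bullet> v = R\<^sup>2 - p \<bullet> p}"
  proof (intro set_eqI iffI)
    fix y assume "y \<in> primal_optima d A"
    then have "y - p \<in> K" "y \<bullet> y = R\<^sup>2" using solution by (auto simp: opt)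
    then show "y \<in> {p + v | v. v \<in> K \<and> v \<bullet> v = R\<^sup>2 - p \<bullet> p}"
      using pythagoras[of "y - p"] by (auto intro!: exI[of _ "y - p"])
  next
    fix y assume "y \<in> {p + v | v. v \<in> K \<and> v \<bullet> v = R\<^sup>2 - p \<bullet> p}"
    then obtain v where v: "y = p + v" "v \<in> K" "v \<bullet> v = R\<^sup>2 - p \<bullet> p" by blast
    then show "y \<in> primal_optima d A"
      using solution[of y] pythagoras[OF v(2)] by (simp add: opt)
  qed
  have "primal_optima d A = {p + cols_mult k V w | w. (L2_set w {..<k})\<^sup>2 = R\<^sup>2 - p \<bullet> p}"
    unfolding opt_K K_def span_cols_eq[OF V] inner_cols_mult[OF V, symmetric] by blast
  moreover have "is_hypersphere_in k ((+) p ` K) p (primal_optima d A)"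
  proof -
    have sub: "subspace K" by (simp add: K_def)
    have rad: "0 \<le> R\<^sup>2 - p \<bullet> p"
    proof -
      obtain v :: "real^'n" where "v \<bullet> v = R\<^sup>2 - p \<bullet> p" using y0 unfolding opt_K by auto
      then show ?thesis by (metis inner_ge_zero)
    qed
    have "dist p (p + v) = sqrt (R\<^sup>2 - p \<bullet> p) \<longleftrightarrow> v \<bullet> v = R\<^sup>2 - p \<bullet> p" for v
      by (simp add: dist_norm norm_eq_sqrt_inner)
    then have "primal_optima d A = {y \<in> (+) p ` K. dist p y = sqrt (R\<^sup>2 - p \<bullet> p)}"
      unfolding opt_K by blast
    moreover have "affine ((+) p ` K)"
      using sub affine_translation subspace_imp_affine by blast
    moreover have "aff_dim ((+) p ` K) = int k"
      using aff_dim_subspace[OF sub] dim_span_cols[OF V] by (simp add: aff_dim_translation_eq K_def)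
    moreover have "p \<in> (+) p ` K" using subspace_0[OF sub] by force
    ultimately show ?thesis
      unfolding is_hypersphere_in_def using rad by (intro conjI exI[of _ "sqrt (R\<^sup>2 - p \<bullet> p)"]) auto
  qed
  ultimately show ?thesis unfolding pp k_def K_def by blast
qed

end
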